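(* For every $\tau\in\mathbb{H}^2$, $$\frac{\theta'[\frac15,1]}{\theta[\frac15,1]}=-\zeta_5^3\,\theta'[1,1]\,\frac{\theta^5[\frac15,1]+3\,\theta^5[\frac35,1]}{10\,\theta^3[\frac15,1]\,\theta^3[\frac35,1]},\qquad \frac{\theta'[\frac35,1]}{\theta[\frac35,1]}=-\zeta_5^3\,\theta'[1,1]\,\frac{3\,\theta^5[\frac15,1]-\theta^5[\frac35,1]}{10\,\theta^3[\frac15,1]\,\theta^3[\frac35,1]}.$$
   Context: $\mathbb{H}^2=\{\tau\in\mathbb{C} : \Im\tau>0\}$ is the upper half plane and $\zeta_k=\exp(2\pi i/k)$. For $\epsilon,\epsilon'\in\mathbb{R}$, $\zeta\in\mathbb{C}$, $\tau\in\mathbb{H}^2$, the theta function with characteristics is $$\theta[\epsilon,\epsilon'](\zeta,\tau)=\sum_{n\in\mathbb{Z}}\exp\left(2\pi i\left[\tfrac12\left(n+\tfrac{\epsilon}{2}\right)^2\tau+\left(n+\tfrac{\epsilon}{2}\right)\left(\zeta+\tfrac{\epsilon'}{2}\right)\right]\right).$$ Write $\theta[\epsilon,\epsilon']=\theta[\epsilon,\epsilon'](0,\tau)$ and $\theta'[\epsilon,\epsilon']=\frac{\partial}{\partial\zeta}\theta[\epsilon,\epsilon'](\zeta,\tau)\big|_{\zeta=0}$; $\theta^k[\epsilon,\epsilon']$ means the $k$-th power of $\theta[\epsilon,\epsilon']$. *)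

theory Defs
  imports "HOL-Analysis.Analysis"
begin

text \<open>
  The unordered sum \<open>infsum\<close> is the actual value of the theta series whenever \<open>Im \<tau> > 0\<close>,
  because the series then converges absolutely.
\<close>
definition theta_char :: "real \<Rightarrow> real \<Rightarrow> complex \<Rightarrow> complex \<Rightarrow> complex" where
  "theta_char \<epsilon> \<epsilon>' \<zeta> \<tau> =
     (\<Sum>\<^sub>\<infinity>n::int. exp (2 * of_real pi * \<i> *
        (1 / 2 * (of_int n + of_real \<epsilon> / 2)\<^sup>2 * \<tau>
         + (of_int n + of_real \<epsilon> / 2) * (\<zeta> + of_real \<epsilon>' / 2))))"

definition theta_const :: "real \<Rightarrow> real \<Rightarrow> complex \<Rightarrow> complex" where
  "theta_const \<epsilon> \<epsilon>' \<tau> = theta_char \<epsilon> \<epsilon>' 0 \<tau>"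

definition theta_deriv :: "real \<Rightarrow> real \<Rightarrow> complex \<Rightarrow> complex" where
  "theta_deriv \<epsilon> \<epsilon>' \<tau> = deriv (\<lambda>\<zeta>. theta_char \<epsilon> \<epsilon>' \<zeta> \<tau>) 0"

definition root_of_unity :: "nat \<Rightarrow> complex" where
  "root_of_unity k = exp (2 * of_real pi * \<i> / of_nat k)"

end

theory Submission
  imports Defs "HOL-Complex_Analysis.Complex_Analysis"
begin


text \<open>
  Put \<open>\<theta>(z) = \<theta>[1,1](z,\<tau>)\<close>, the odd theta function. Writing \<open>\<epsilon> = 1 + 2s\<close>, the function
  \<open>\<theta>[\<epsilon>,1](z)\<close> is an exponential of an affine function of \<open>z\<close> times \<open>\<theta>(z + s\<tau>)\<close>, so the claim
  concerns logarithmic derivatives of \<open>\<theta>\<close> at the points \<open>-2\<tau>/5\<close> and \<open>-\<tau>/5\<close>.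

  The source of all relations is the addition formula
  \<open>\<theta>(x + y) \<theta>(x - y) = P(x) Q(y) - Q(x) P(y)\<close>, where \<open>P\<close> and \<open>Q\<close> are theta functions of modulus
  \<open>2\<tau>\<close> (\<open>theta_11_addition\<close>). It says that \<open>\<theta>(x + y) \<theta>(x - y)\<close> is a 2-by-2 determinant, and the
  Pluecker relation between such determinants becomes a quartic relation: for \<open>a + b + c + d = 0\<close>,
  the product \<open>\<theta>(z + a) \<theta>(z + b) \<theta>(z + c) \<theta>(z + d)\<close> has odd part
  \<open>- \<theta>(2z) \<theta>(a + b) \<theta>(b + c) \<theta>(c + a) / 2\<close> (\<open>theta_11_quartic_relation\<close>). Differentiating at
  \<open>z = 0\<close> expresses a sum of four logarithmic derivatives through \<open>\<theta>'(0)\<close> and theta values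
  (\<open>theta_11_product_deriv\<close>, and \<open>theta_char_product_deriv\<close> in terms of characteristics).

  Let \<open>A, B\<close> be the constants of characteristics \<open>[1/5,1], [3/5,1]\<close>, with derivatives \<open>A', B'\<close>, and
  \<open>K = \<zeta>\<^sub>5\<^sup>3 \<theta>'(0)\<close>. The characteristics \<open>3/5, 3/5, 3/5, 11/5\<close> and \<open>1/5, 1/5, 1/5, 17/5\<close> both add
  up to 4; modulo the symmetries \<open>\<epsilon> \<mapsto> \<epsilon> + 2\<close> and \<open>(\<epsilon>,z) \<mapsto> (-\<epsilon>,-z)\<close> they only involve \<open>1/5\<close> and
  \<open>3/5\<close>, and they give
  \<open>A'/A + 3 B'/B = - K A\<^sup>2/B\<^sup>3\<close> and \<open>3 A'/A - B'/B = - K B\<^sup>2/A\<^sup>3\<close>.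
  Solving this linear system (of determinant \<open>-10\<close>, which explains the denominator) is the theorem.

  The division requires \<open>A\<close> and \<open>B\<close> to be nonzero. If one of them vanishes, the cleared form of
  the system forces the other to vanish too, unless \<open>\<theta>'(0) = 0\<close>; but then the Wronskian of \<open>P\<close> and
  \<open>Q\<close> is zero, so \<open>P\<close> and \<open>Q\<close> are linearly dependent and \<open>\<theta>\<close> is identically zero
  (\<open>theta_11_deriv_0_eq_0_imp_eq_0\<close>), whence again \<open>A = B = 0\<close>. In that case both sides of both
  equations are 0, because \<open>x / 0 = 0\<close>.
\<close>
section \<open>The terms of the theta series\<close>

definition ee :: "complex \<Rightarrow> complex" where
  "ee x = exp (2 * of_real pi * \<i> * x)"

lemma ee_add: "ee (x + y) = ee x * ee y"
  by (simp add: ee_def distrib_left exp_add)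

lemma ee_0 [simp]: "ee 0 = 1"
  by (simp add: ee_def)

lemma ee_nonzero [simp]: "ee x \<noteq> 0"
  by (simp add: ee_def)

lemma ee_of_int [simp]: "ee (of_int n) = 1"
  unfolding ee_def using exp_integer_2pi[of "of_int n"] by (simp add: mult_ac)

lemma ee_half: "ee (1/2) = -1"
  by (simp add: ee_def)

lemma norm_ee: "norm (ee x) = exp (- (2 * pi * Im x))"
  by (simp add: ee_def)

definition theta_term :: "real \<Rightarrow> real \<Rightarrow> complex \<Rightarrow> complex \<Rightarrow> int \<Rightarrow> complex" where
  "theta_term \<epsilon> \<epsilon>' z \<tau> n =
     ee (1 / 2 * (of_int n + of_real \<epsilon> / 2)\<^sup>2 * \<tau> + (of_int n + of_real \<epsilon> / 2) * (z + of_real \<epsilon>' / 2))"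

lemma theta_char_eq_infsum: "theta_char \<epsilon> \<epsilon>' z \<tau> = (\<Sum>\<^sub>\<infinity>n. theta_term \<epsilon> \<epsilon>' z \<tau> n)"
  by (simp add: theta_char_def theta_term_def ee_def)

lemma summable_on_exp_neg_abs: "(\<lambda>n::int. exp (- \<bar>real_of_int n\<bar>)) summable_on UNIV"
proof -
  have geo: "(\<lambda>n::nat. exp (- real n)) summable_on UNIV"
  proof -
    have "summable (\<lambda>n::nat. exp (-1::real) ^ n)"
      by (rule summable_geometric) simp
    then have "summable (\<lambda>n::nat. norm (exp (- real n)))"
      by (simp add: exp_of_nat_mult [symmetric])
    then show ?thesis
      by (metis norm_summable_imp_summable_on)
  qed
  have "(\<lambda>n::int. exp (- \<bar>real_of_int n\<bar>)) summable_on range int"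
    using geo by (subst summable_on_reindex) (auto simp: o_def)
  moreover have "(\<lambda>n::int. exp (- \<bar>real_of_int n\<bar>)) summable_on range (\<lambda>n. - int n)"
    using geo by (subst summable_on_reindex) (auto simp: o_def inj_def)
  moreover have "range int \<union> range (\<lambda>n. - int n) = (UNIV :: int set)"
    by (metis (no_types, lifting) UNIV_eq_I UnCI int_cases2 rangeI)
  ultimately show ?thesis
    using summable_on_union by metis
qed

text \<open>
  With \<open>x = n + \<epsilon>/2\<close> the term has size \<open>exp(- \<pi> Im \<tau> x\<^sup>2 - 2 \<pi> x Im z)\<close>; completing the square
  trades the Gaussian decay for the weaker \<open>exp(- |n|)\<close>, with a constant that depends on \<open>z\<close> only
  through a bound \<open>R\<close>. This one majorant gives absolute convergence, and holomorphy through the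
  Weierstrass test.
\<close>
lemma norm_theta_term_le:
  assumes "Im \<tau> > 0" "norm z \<le> R"
  shows "norm (theta_term \<epsilon> \<epsilon>' z \<tau> n) \<le>
           exp ((2 * pi * R + 1)\<^sup>2 / (4 * pi * Im \<tau>) + \<bar>\<epsilon> / 2\<bar>) * exp (- \<bar>real_of_int n\<bar>)"
proof -
  define x where "x = real_of_int n + \<epsilon> / 2"
  define t where "t = pi * Im \<tau>"
  define r where "r = 2 * pi * R + 1"
  have t: "t > 0" using assms by (simp add: t_def)
  have x: "of_int n + of_real \<epsilon> / 2 = complex_of_real x"
    by (simp add: x_def)
  have "norm (theta_term \<epsilon> \<epsilon>' z \<tau> n) = exp (- (t * x\<^sup>2) - 2 * pi * (x * Im z))"
    unfolding theta_term_def x norm_ee t_def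
    by (simp add: power2_eq_square algebra_simps)
  also have "- (t * x\<^sup>2) - 2 * pi * (x * Im z) \<le> - (t * x\<^sup>2) + 2 * pi * (\<bar>x\<bar> * R)"
  proof -
    have "- (x * Im z) \<le> \<bar>x\<bar> * \<bar>Im z\<bar>" by (metis abs_ge_minus_self abs_mult)
    also have "\<dots> \<le> \<bar>x\<bar> * R"
      using assms(2) abs_Im_le_cmod[of z] by (intro mult_left_mono) auto
    finally have "2 * pi * (- (x * Im z)) \<le> 2 * pi * (\<bar>x\<bar> * R)"
      by (intro mult_left_mono) auto
    then show ?thesis by simp
  qed
  also have "\<dots> \<le> r\<^sup>2 / (4 * t) - \<bar>x\<bar>"
  proof -
    have "0 \<le> (2 * t * \<bar>x\<bar> - r)\<^sup>2 / (4 * t)" using t by simp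
    also have "\<dots> = t * x\<^sup>2 - r * \<bar>x\<bar> + r\<^sup>2 / (4 * t)"
      using t by (simp add: field_simps power2_eq_square)
    finally show ?thesis by (simp add: r_def algebra_simps)
  qed
  also have "\<dots> \<le> r\<^sup>2 / (4 * t) + \<bar>\<epsilon> / 2\<bar> - \<bar>real_of_int n\<bar>"
    by (simp add: x_def)
  finally show ?thesis
    by (simp add: r_def t_def exp_add [symmetric] algebra_simps)
qed

lemma theta_term_abs_summable:
  assumes "Im \<tau> > 0"
  shows "(\<lambda>n. norm (theta_term \<epsilon> \<epsilon>' z \<tau> n)) summable_on UNIV"
  by (rule Infinite_Sum.abs_summable_on_comparison_test', rule summable_on_cmult_right [OF summable_on_exp_neg_abs])
     (rule norm_theta_term_le [OF assms order_refl])

lemma theta_char_holomorphic: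
  assumes "Im \<tau> > 0"
  shows "(\<lambda>z. theta_char \<epsilon> \<epsilon>' z \<tau>) holomorphic_on UNIV"
proof -
  have "(\<lambda>z. theta_char \<epsilon> \<epsilon>' z \<tau>) holomorphic_on ball 0 R" for R
  proof -
    have "uniform_limit (cball 0 R) (\<lambda>X z. \<Sum>n\<in>X. theta_term \<epsilon> \<epsilon>' z \<tau> n)
            (\<lambda>z. \<Sum>\<^sub>\<infinity>n. theta_term \<epsilon> \<epsilon>' z \<tau> n) (finite_subsets_at_top UNIV)"
      by (rule Weierstrass_m_test_general
          [OF norm_theta_term_le[OF assms] summable_on_cmult_right [OF summable_on_exp_neg_abs]]) auto
    then show ?thesis
      unfolding theta_char_eq_infsum
    proof (rule holomorphic_uniform_limit [rotated])
      show "\<forall>\<^sub>F X in finite_subsets_at_top UNIV.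
              continuous_on (cball 0 R) (\<lambda>z. \<Sum>n\<in>X. theta_term \<epsilon> \<epsilon>' z \<tau> n) \<and>
              (\<lambda>z. \<Sum>n\<in>X. theta_term \<epsilon> \<epsilon>' z \<tau> n) holomorphic_on ball 0 R"
        unfolding theta_term_def ee_def
        by (intro always_eventually allI conjI continuous_intros holomorphic_intros) auto
    qed auto
  qed
  then have "(\<lambda>z. theta_char \<epsilon> \<epsilon>' z \<tau>) field_differentiable at z" for z
    by (rule holomorphic_on_imp_differentiable_at[of _ "ball 0 (norm z + 1)"]) auto
  then show ?thesis
    by (simp add: holomorphic_on_def field_differentiable_at_within)
qed

lemma theta_char_has_field_derivative:
  assumes "Im \<tau> > 0"
  shows "((\<lambda>z. theta_char \<epsilon> \<epsilon>' z \<tau>) has_field_derivative deriv (\<lambda>z. theta_char \<epsilon> \<epsilon>' z \<tau>) z) (at z)"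
  using holomorphic_derivI[OF theta_char_holomorphic[OF assms] open_UNIV UNIV_I] .

lemma theta_char_add_2: "theta_char (\<epsilon> + 2) \<epsilon>' z \<tau> = theta_char \<epsilon> \<epsilon>' z \<tau>"
  unfolding theta_char_eq_infsum
  by (rule infsum_reindex_bij_witness[of _ "\<lambda>n. n - 1" "\<lambda>n. n + 1"])
     (auto simp: theta_term_def algebra_simps add_divide_distrib)

text \<open>
  The substitution \<open>n \<mapsto> -n\<close> turns \<open>\<epsilon>' = 1\<close> into \<open>\<epsilon>' = -1\<close>; returning to \<open>\<epsilon>' = 1\<close> costs a factor
  independent of \<open>n\<close>.
\<close>
lemma theta_char_minus: "theta_char \<epsilon> 1 (- z) \<tau> = ee (of_real \<epsilon> / 2) * theta_char (- \<epsilon>) 1 z \<tau>"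
proof -
  have "theta_term \<epsilon> 1 (- z) \<tau> n = ee (of_real \<epsilon> / 2) * theta_term (- \<epsilon>) 1 z \<tau> (- n)" for n
  proof -
    have "1 / 2 * (of_int n + of_real \<epsilon> / 2)\<^sup>2 * \<tau> + (of_int n + of_real \<epsilon> / 2) * (- z + of_real 1 / 2)
      = of_real \<epsilon> / 2 + (1 / 2 * (of_int (- n) + of_real (- \<epsilon>) / 2)\<^sup>2 * \<tau>
            + (of_int (- n) + of_real (- \<epsilon>) / 2) * (z + of_real 1 / 2)) + of_int n"
      by (simp add: field_simps power2_eq_square)
    then show ?thesis
      unfolding theta_term_def by (simp only: ee_add ee_of_int mult_1_right)
  qed
  then have "theta_char \<epsilon> 1 (- z) \<tau> =
      (\<Sum>\<^sub>\<infinity>n. ee (of_real \<epsilon> / 2) * theta_term (- \<epsilon>) 1 z \<tau> (- n))"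
    by (simp add: theta_char_eq_infsum)
  also have "\<dots> = (\<Sum>\<^sub>\<infinity>n. ee (of_real \<epsilon> / 2) * theta_term (- \<epsilon>) 1 z \<tau> n)"
    by (rule infsum_reindex_bij_witness[of _ uminus uminus]) auto
  also have "\<dots> = ee (of_real \<epsilon> / 2) * theta_char (- \<epsilon>) 1 z \<tau>"
    by (simp add: theta_char_eq_infsum infsum_cmult_right')
  finally show ?thesis .
qed

text \<open>
  A change of characteristic is a translation of the argument: expand the square
  \<open>(n + 1/2 + s)\<^sup>2\<close> in every term.
\<close>
lemma theta_char_eq_theta_11:
  assumes "\<epsilon> = 1 + 2 * s"
  shows "theta_char \<epsilon> 1 z \<tau> =
           ee (of_real s ^ 2 * \<tau> / 2 + of_real s * (z + 1/2)) * theta_char 1 1 (z + of_real s * \<tau>) \<tau>"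
proof -
  have "theta_term \<epsilon> 1 z \<tau> n =
      ee (of_real s ^ 2 * \<tau> / 2 + of_real s * (z + 1/2)) * theta_term 1 1 (z + of_real s * \<tau>) \<tau> n" for n
    unfolding theta_term_def ee_add [symmetric]
    by (rule arg_cong[of _ _ ee]) (simp add: assms field_simps power2_eq_square)
  then show ?thesis
    by (simp add: theta_char_eq_infsum infsum_cmult_right')
qed

lemma theta_11_odd: "theta_char 1 1 (- z) \<tau> = - theta_char 1 1 z \<tau>"
  using theta_char_minus[of 1 z \<tau>] theta_char_add_2[of "-1" 1 z \<tau>] by (simp add: ee_half)

section \<open>The addition formula\<close>

lemma abs_summable_infsum_mult:
  fixes f :: "'a \<Rightarrow> complex" and g :: "'b \<Rightarrow> complex"
  assumes f: "(\<lambda>x. norm (f x)) summable_on A" and g: "(\<lambda>y. norm (g y)) summable_on B"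
  shows "(\<lambda>(x, y). f x * g y) summable_on A \<times> B"
    and "infsum (\<lambda>(x, y). f x * g y) (A \<times> B) = infsum f A * infsum g B"
proof -
  have "(\<lambda>z. norm ((\<lambda>(x, y). f x * g y) z)) summable_on A \<times> B"
    unfolding Infinite_Sum.abs_summable_on_Sigma_iff
    using f g by (auto simp: norm_mult infsum_cmult_right' abs_mult abs_of_nonneg[OF infsum_nonneg] intro!: summable_on_cmult_left summable_on_cmult_right infsum_nonneg)
  then show *: "(\<lambda>(x, y). f x * g y) summable_on A \<times> B"
    by (rule Infinite_Sum.abs_summable_summable)
  show "infsum (\<lambda>(x, y). f x * g y) (A \<times> B) = infsum f A * infsum g B"
    using infsum_Sigma'_banach[OF *] by (simp add: infsum_cmult_right' infsum_cmult_left')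
qed

text \<open>
  In the variable \<open>x\<close>, these two functions are the standard basis of the theta functions of
  order two for \<open>\<tau>\<close>.
\<close>
definition theta_P :: "complex \<Rightarrow> complex \<Rightarrow> complex" where
  "theta_P \<tau> x = theta_char 0 0 (2 * x) (2 * \<tau>)"

definition theta_Q :: "complex \<Rightarrow> complex \<Rightarrow> complex" where
  "theta_Q \<tau> x = theta_char 1 0 (2 * x) (2 * \<tau>)"

text \<open>
  In the product of the two series, indexed by \<open>(m,n)\<close>, pass to \<open>k = m + n + 1\<close> and \<open>l = m - n\<close>.
  The exponent separates into a quadratic polynomial in \<open>k\<close> and one in \<open>l\<close>, because
  \<open>(m + 1/2)\<^sup>2 + (n + 1/2)\<^sup>2 = (k\<^sup>2 + l\<^sup>2)/2\<close>. The pairs \<open>(k,l)\<close> that occur are those of opposite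
  parity: \<open>k\<close> even and \<open>l\<close> odd gives the first product, \<open>k\<close> odd and \<open>l\<close> even the second. The sign
  is the factor \<open>(-1)\<^sup>k\<close> that the shift of the argument by \<open>\<epsilon>'/2 = 1/2\<close> produces.
\<close>
lemma theta_11_addition:
  assumes \<tau>: "Im \<tau> > 0"
  shows "theta_char 1 1 (x + y) \<tau> * theta_char 1 1 (x - y) \<tau> =
           theta_P \<tau> x * theta_Q \<tau> y - theta_Q \<tau> x * theta_P \<tau> y"
proof -
  define f where "f = (\<lambda>(m, n). theta_term 1 1 (x + y) \<tau> m * theta_term 1 1 (x - y) \<tau> n)"
  define U where "U = {(m, n). odd (m - n :: int)}"
  define V where "V = {(m, n). even (m - n :: int)}"
  have UV: "U \<inter> V = {}" "U \<union> V = UNIV \<times> UNIV" by (auto simp: U_def V_def)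
  have \<tau>2: "Im (2 * \<tau>) > 0" using \<tau> by simp
  note summ = theta_term_abs_summable[OF \<tau>] theta_term_abs_summable[OF \<tau>2]
  have f: "f summable_on UNIV \<times> UNIV"
    and inf: "infsum f (UNIV \<times> UNIV) = theta_char 1 1 (x + y) \<tau> * theta_char 1 1 (x - y) \<tau>"
    unfolding f_def theta_char_eq_infsum by (intro abs_summable_infsum_mult summ)+
  \<comment> \<open>Here \<open>k = 2p\<close> and \<open>l = 2q + 1\<close>.\<close>
  have "infsum f U = (\<Sum>\<^sub>\<infinity>(p, q)\<in>UNIV \<times> UNIV.
          theta_term 0 0 (2 * x) (2 * \<tau>) p * theta_term 1 0 (2 * y) (2 * \<tau>) q)"
  proof (rule infsum_reindex_bij_witness
      [of _ "\<lambda>(p, q). (p + q, p - q - 1)" "\<lambda>(m, n). ((m + n + 1) div 2, (m - n) div 2)"], goal_cases)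
    case (5 a)
    then obtain m n where a: "a = (m, n)" "odd (m - n)" by (auto simp: U_def)
    then obtain q where q: "m - n = 2 * q + 1" by (metis oddE)
    define p where "p = m - q"
    have mn: "m = p + q" "n = p - q - 1" using q by (auto simp: p_def)
    have "theta_term 1 1 (x + y) \<tau> m * theta_term 1 1 (x - y) \<tau> n =
          theta_term 0 0 (2 * x) (2 * \<tau>) p * theta_term 1 0 (2 * y) (2 * \<tau>) q * ee (of_int p)"
      unfolding theta_term_def ee_add [symmetric]
      by (rule arg_cong[of _ _ ee]) (simp add: mn field_simps power2_eq_square)
    then show ?case by (simp add: a f_def mn)
  qed (unfold U_def, (clarsimp; presburger)+)
  also have "\<dots> = theta_P \<tau> x * theta_Q \<tau> y"
    unfolding theta_P_def theta_Q_def theta_char_eq_infsum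
    by (rule abs_summable_infsum_mult summ)+
  finally have 1: "infsum f U = theta_P \<tau> x * theta_Q \<tau> y" .
  \<comment> \<open>Here \<open>k = 2p + 1\<close> and \<open>l = 2q\<close>.\<close>
  have "infsum f V = (\<Sum>\<^sub>\<infinity>(p, q)\<in>UNIV \<times> UNIV.
          - theta_term 1 0 (2 * x) (2 * \<tau>) p * theta_term 0 0 (2 * y) (2 * \<tau>) q)"
  proof (rule infsum_reindex_bij_witness
      [of _ "\<lambda>(p, q). (p + q, p - q)" "\<lambda>(m, n). ((m + n) div 2, (m - n) div 2)"], goal_cases)
    case (5 a)
    then obtain m n where a: "a = (m, n)" "even (m - n)" by (auto simp: V_def)
    then obtain q where q: "m - n = 2 * q" by (metis evenE)
    define p where "p = m - q"
    have mn: "m = p + q" "n = p - q" using q by (auto simp: p_def)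
    have "theta_term 1 1 (x + y) \<tau> m * theta_term 1 1 (x - y) \<tau> n =
          theta_term 1 0 (2 * x) (2 * \<tau>) p * theta_term 0 0 (2 * y) (2 * \<tau>) q * ee (of_int p) * ee (1/2)"
      unfolding theta_term_def ee_add [symmetric]
      by (rule arg_cong[of _ _ ee]) (simp add: mn field_simps power2_eq_square)
    then show ?case by (simp add: a f_def mn ee_half)
  qed (unfold V_def, (clarsimp; presburger)+)
  also have "\<dots> = (\<Sum>\<^sub>\<infinity>p. - theta_term 1 0 (2 * x) (2 * \<tau>) p) * theta_P \<tau> y"
    unfolding theta_P_def theta_char_eq_infsum
    by (rule abs_summable_infsum_mult) (simp_all add: summ)
  also have "\<dots> = - (theta_Q \<tau> x * theta_P \<tau> y)"
    by (simp add: theta_Q_def theta_char_eq_infsum infsum_uminus)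
  finally have 2: "infsum f V = - (theta_Q \<tau> x * theta_P \<tau> y)" .
  have "infsum f (UNIV \<times> UNIV) = infsum f U + infsum f V"
    unfolding UV(2) [symmetric]
    by (rule infsum_Un_disjoint) (use summable_on_subset[OF f] UV in auto)
  with 1 2 inf show ?thesis by simp
qed

section \<open>The quartic relation and its derivative\<close>

text \<open>
  Each of the two quartic products is a product of two determinants \<open>W\<close> by the addition formula,
  and their difference factors by the Pluecker relation
  \<open>W(X,u) W(Y,v) - W(Y,u) W(X,v) = W(X,Y) W(u,v)\<close> at \<open>X = z + p\<close>, \<open>Y = z - p\<close>.
\<close>
lemma theta_11_quartic_relation:
  assumes \<tau>: "Im \<tau> > 0" and sum: "a + b + c + d = 0"
  defines "\<theta> \<equiv> \<lambda>z. theta_char 1 1 z \<tau>"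
  shows "\<theta> (z + a) * \<theta> (z + b) * \<theta> (z + c) * \<theta> (z + d) - \<theta> (z - a) * \<theta> (z - b) * \<theta> (z - c) * \<theta> (z - d) =
           - \<theta> (2 * z) * \<theta> (a + b) * \<theta> (b + c) * \<theta> (c + a)"
proof -
  define W where "W = (\<lambda>x y. theta_P \<tau> x * theta_Q \<tau> y - theta_Q \<tau> x * theta_P \<tau> y)"
  define p u v where "p = (a + b) / 2" and "u = (a - b) / 2" and "v = (c - d) / 2"
  have d: "d = - a - b - c" using sum by (simp add: algebra_simps eq_neg_iff_add_eq_0)
  have W: "\<theta> s * \<theta> t = W x y" if "s = x + y" "t = x - y" for s t x y
    using theta_11_addition[OF \<tau>] that by (simp add: W_def \<theta>_def)
  have "\<theta> (z + a) * \<theta> (z + b) = W (z + p) u" "\<theta> (z + c) * \<theta> (z + d) = W (z - p) v"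
       "\<theta> (z - b) * \<theta> (z - a) = W (z - p) u" "\<theta> (z - d) * \<theta> (z - c) = W (z + p) v"
       "\<theta> (2 * z) * \<theta> (a + b) = W (z + p) (z - p)"
       "\<theta> (c + a) * \<theta> (- (b + c)) = W u v"
    by (rule W; simp add: p_def u_def v_def d field_simps)+
  note products = this
  have pluecker: "W (z + p) u * W (z - p) v - W (z - p) u * W (z + p) v = W (z + p) (z - p) * W u v"
    by (simp add: W_def algebra_simps)
  have odd: "\<theta> (- (b + c)) = - \<theta> (b + c)"
    unfolding \<theta>_def by (rule theta_11_odd)
  show ?thesis
    using pluecker unfolding products [symmetric] odd by (simp add: mult_ac)
qed


text \<open>
  As \<open>\<theta>\<close> is odd, replacing \<open>z\<close> by \<open>-z\<close> in the product \<open>G\<close> on the left amounts to changing the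
  signs of \<open>a, b, c, d\<close>. So the quartic relation gives \<open>G(z) - G(-z)\<close>, which has derivative
  \<open>2 G'(0)\<close> at the origin. After division by \<open>G(0)\<close> this becomes the classical formula
  \<open>\<zeta>(a) + \<zeta>(b) + \<zeta>(c) - \<zeta>(a + b + c) =
     \<sigma>(a + b) \<sigma>(b + c) \<sigma>(c + a) / (\<sigma>(a) \<sigma>(b) \<sigma>(c) \<sigma>(a + b + c))\<close> for Weierstrass functions.
\<close>
lemma theta_11_product_deriv:
  assumes \<tau>: "Im \<tau> > 0" and sum: "a + b + c + d = 0"
  defines "\<theta> \<equiv> \<lambda>z. theta_char 1 1 z \<tau>"
  shows "((\<lambda>z. \<theta> (z + a) * \<theta> (z + b) * \<theta> (z + c) * \<theta> (z + d)) has_field_derivative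
           - deriv \<theta> 0 * \<theta> (a + b) * \<theta> (b + c) * \<theta> (c + a)) (at 0)"
proof -
  define G where "G = (\<lambda>z. \<theta> (z + a) * \<theta> (z + b) * \<theta> (z + c) * \<theta> (z + d))"
  have \<theta>: "(\<theta> has_field_derivative deriv \<theta> z) (at z)" for z
    unfolding \<theta>_def by (rule theta_char_has_field_derivative[OF \<tau>])
  note [derivative_intros] = DERIV_chain2[OF \<theta>]
  have "\<exists>D. (G has_field_derivative D) (at 0)"
    unfolding G_def by (rule exI) (rule derivative_eq_intros refl)+
  then obtain D where D: "(G has_field_derivative D) (at 0)" by blast
  have odd: "\<theta> (- z) = - \<theta> z" for z
    unfolding \<theta>_def by (rule theta_11_odd)
  have neg: "G (- z) = \<theta> (z - a) * \<theta> (z - b) * \<theta> (z - c) * \<theta> (z - d)" for z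
    using odd[of "z - a"] odd[of "z - b"] odd[of "z - c"] odd[of "z - d"]
    by (simp add: G_def)
  have deriv_diff: "((\<lambda>z. G z - G (- z)) has_field_derivative D - D * (- 1)) (at 0)"
    by (intro DERIV_diff D DERIV_chain2[of G D uminus]) (use D in \<open>auto intro!: derivative_eq_intros\<close>)
  have diff: "(\<lambda>z. G z - G (- z)) = (\<lambda>z. - \<theta> (2 * z) * \<theta> (a + b) * \<theta> (b + c) * \<theta> (c + a))"
    using theta_11_quartic_relation[OF \<tau> sum] by (simp add: fun_eq_iff neg) (simp add: G_def \<theta>_def)
  have "((\<lambda>z. G z - G (- z)) has_field_derivative
           - (deriv \<theta> 0 * 2) * \<theta> (a + b) * \<theta> (b + c) * \<theta> (c + a)) (at 0)"
    unfolding diff by (rule derivative_eq_intros refl)+ simp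
  from DERIV_unique[OF deriv_diff this] have "D = - deriv \<theta> 0 * \<theta> (a + b) * \<theta> (b + c) * \<theta> (c + a)"
    by simp
  with D show ?thesis by (simp add: G_def)
qed

text \<open>
  The translations \<open>s\<^sub>i\<tau>\<close> belonging to the four characteristics add up to 0. The exponential
  factors therefore multiply to a constant \<open>C\<close>, and \<open>C\<close> agrees up to the factor of modulus one
  shown with the factor of the three characteristics \<open>\<epsilon>\<^sub>i + \<epsilon>\<^sub>j - 1\<close>, whose translations are
  \<open>(s\<^sub>i + s\<^sub>j)\<tau>\<close>: the terms quadratic in the \<open>s\<^sub>i\<close> cancel by
  \<open>(s\<^sub>1 + s\<^sub>2)\<^sup>2 + (s\<^sub>2 + s\<^sub>3)\<^sup>2 + (s\<^sub>3 + s\<^sub>1)\<^sup>2 = s\<^sub>1\<^sup>2 + s\<^sub>2\<^sup>2 + s\<^sub>3\<^sup>2 + (s\<^sub>1 + s\<^sub>2 + s\<^sub>3)\<^sup>2\<close>.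
\<close>
lemma theta_char_product_deriv:
  assumes \<tau>: "Im \<tau> > 0" and sum: "\<epsilon>\<^sub>1 + \<epsilon>\<^sub>2 + \<epsilon>\<^sub>3 + \<epsilon>\<^sub>4 = 4"
  defines "\<theta> \<equiv> \<lambda>\<epsilon> z. theta_char \<epsilon> 1 z \<tau>"
  shows "((\<lambda>z. \<theta> \<epsilon>\<^sub>1 z * \<theta> \<epsilon>\<^sub>2 z * \<theta> \<epsilon>\<^sub>3 z * \<theta> \<epsilon>\<^sub>4 z) has_field_derivative
           - ee ((of_real \<epsilon>\<^sub>4 - 1) / 2) * deriv (\<theta> 1) 0 *
             \<theta> (\<epsilon>\<^sub>1 + \<epsilon>\<^sub>2 - 1) 0 * \<theta> (\<epsilon>\<^sub>2 + \<epsilon>\<^sub>3 - 1) 0 * \<theta> (\<epsilon>\<^sub>3 + \<epsilon>\<^sub>1 - 1) 0) (at 0)"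
proof -
  define s where "s = (\<lambda>\<epsilon>::real. (\<epsilon> - 1) / 2)"
  define r where "r = (\<lambda>\<epsilon>. of_real (s \<epsilon>) :: complex)"
  define E where "E = (\<lambda>\<epsilon> z. ee (r \<epsilon> ^ 2 * \<tau> / 2 + r \<epsilon> * (z + 1/2)))"
  have \<theta>: "\<theta> \<epsilon> z = E \<epsilon> z * \<theta> 1 (z + r \<epsilon> * \<tau>)" for \<epsilon> z
    unfolding \<theta>_def E_def r_def
    by (rule theta_char_eq_theta_11) (simp add: s_def field_simps)
  have r4: "r \<epsilon>\<^sub>4 = - r \<epsilon>\<^sub>1 - r \<epsilon>\<^sub>2 - r \<epsilon>\<^sub>3"
  proof -
    have "s \<epsilon>\<^sub>4 = - s \<epsilon>\<^sub>1 - s \<epsilon>\<^sub>2 - s \<epsilon>\<^sub>3"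
      using sum by (simp add: s_def field_simps)
    then show ?thesis by (simp add: r_def)
  qed
  have r_add: "r (\<delta> + \<epsilon> - 1) = r \<delta> + r \<epsilon>" for \<delta> \<epsilon>
    by (simp add: r_def s_def field_simps)
  define C where "C = E \<epsilon>\<^sub>1 0 * E \<epsilon>\<^sub>2 0 * E \<epsilon>\<^sub>3 0 * E \<epsilon>\<^sub>4 0"
  have C: "E \<epsilon>\<^sub>1 z * E \<epsilon>\<^sub>2 z * E \<epsilon>\<^sub>3 z * E \<epsilon>\<^sub>4 z = C" for z
    unfolding C_def E_def ee_add [symmetric] by (rule arg_cong[of _ _ ee]) (simp add: r4 algebra_simps)
  have C': "C = ee (r \<epsilon>\<^sub>4) * (E (\<epsilon>\<^sub>1 + \<epsilon>\<^sub>2 - 1) 0 * E (\<epsilon>\<^sub>2 + \<epsilon>\<^sub>3 - 1) 0 * E (\<epsilon>\<^sub>3 + \<epsilon>\<^sub>1 - 1) 0)"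
    unfolding C_def E_def ee_add [symmetric] r_add r4
    by (rule arg_cong[of _ _ ee]) (simp add: field_simps power2_eq_square)
  let ?\<Theta> = "\<lambda>z. \<theta> 1 (z + r \<epsilon>\<^sub>1 * \<tau>) * \<theta> 1 (z + r \<epsilon>\<^sub>2 * \<tau>) * \<theta> 1 (z + r \<epsilon>\<^sub>3 * \<tau>) * \<theta> 1 (z + r \<epsilon>\<^sub>4 * \<tau>)"
  have "(?\<Theta> has_field_derivative - deriv (\<theta> 1) 0 * \<theta> 1 (r \<epsilon>\<^sub>1 * \<tau> + r \<epsilon>\<^sub>2 * \<tau>)
           * \<theta> 1 (r \<epsilon>\<^sub>2 * \<tau> + r \<epsilon>\<^sub>3 * \<tau>) * \<theta> 1 (r \<epsilon>\<^sub>3 * \<tau> + r \<epsilon>\<^sub>1 * \<tau>)) (at 0)"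
    unfolding \<theta>_def by (rule theta_11_product_deriv[OF \<tau>]) (simp add: r4 algebra_simps)
  from DERIV_cmult[OF this, of C]
  have "((\<lambda>z. C * ?\<Theta> z) has_field_derivative
          - ee (r \<epsilon>\<^sub>4) * deriv (\<theta> 1) 0 * \<theta> (\<epsilon>\<^sub>1 + \<epsilon>\<^sub>2 - 1) 0 * \<theta> (\<epsilon>\<^sub>2 + \<epsilon>\<^sub>3 - 1) 0 * \<theta> (\<epsilon>\<^sub>3 + \<epsilon>\<^sub>1 - 1) 0) (at 0)"
    unfolding C' \<theta>[of "_ + _ - 1"] r_add by (simp add: algebra_simps)
  moreover have "(\<lambda>z. C * ?\<Theta> z) = (\<lambda>z. \<theta> \<epsilon>\<^sub>1 z * \<theta> \<epsilon>\<^sub>2 z * \<theta> \<epsilon>\<^sub>3 z * \<theta> \<epsilon>\<^sub>4 z)"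
  proof
    fix z
    show "C * ?\<Theta> z = \<theta> \<epsilon>\<^sub>1 z * \<theta> \<epsilon>\<^sub>2 z * \<theta> \<epsilon>\<^sub>3 z * \<theta> \<epsilon>\<^sub>4 z"
      unfolding C[of z, symmetric] \<theta>[of "\<epsilon>\<^sub>1"] \<theta>[of "\<epsilon>\<^sub>2"] \<theta>[of "\<epsilon>\<^sub>3"] \<theta>[of "\<epsilon>\<^sub>4"] by (simp only: mult_ac)
  qed
  ultimately show ?thesis
    by (simp add: r_def s_def)
qed


section \<open>Vanishing of the derivative at the origin\<close>

text \<open>
  Differentiating the addition formula in \<open>x\<close> at \<open>x = y\<close> gives \<open>\<theta>'(0) \<theta>(2y)\<close> on the left and the
  Wronskian of \<open>P\<close> and \<open>Q\<close> on the right. If it vanishes, \<open>Q/P\<close> is constant near any point with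
  \<open>P \<noteq> 0\<close>, hence \<open>P\<close> and \<open>Q\<close> are proportional everywhere by analytic continuation, and the
  determinant in the addition formula is zero.
\<close>
lemma theta_11_deriv_0_eq_0_imp_eq_0:
  assumes \<tau>: "Im \<tau> > 0" and zero: "deriv (\<lambda>z. theta_char 1 1 z \<tau>) 0 = 0"
  shows "theta_char 1 1 z \<tau> = 0"
proof -
  define \<theta> P Q where "\<theta> = (\<lambda>z. theta_char 1 1 z \<tau>)" and "P = theta_P \<tau>" and "Q = theta_Q \<tau>"
  have addition: "\<theta> (x + y) * \<theta> (x - y) = P x * Q y - Q x * P y" for x y
    unfolding \<theta>_def P_def Q_def by (rule theta_11_addition[OF \<tau>])
  have \<tau>2: "Im (2 * \<tau>) > 0" using \<tau> by simp
  have \<theta>': "(\<theta> has_field_derivative deriv \<theta> x) (at x)" for x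
    unfolding \<theta>_def by (rule theta_char_has_field_derivative[OF \<tau>])
  have "P holomorphic_on UNIV" "Q holomorphic_on UNIV"
    unfolding P_def Q_def theta_P_def theta_Q_def
    by (rule holomorphic_on_compose_gen[OF _ theta_char_holomorphic[OF \<tau>2], unfolded o_def];
        auto intro!: holomorphic_intros)+
  note hol = this
  have P': "(P has_field_derivative deriv P x) (at x)" and Q': "(Q has_field_derivative deriv Q x) (at x)" for x
    by (rule holomorphic_derivI[OF _ open_UNIV UNIV_I], rule hol)+
  have "\<theta> 0 = 0"
    using theta_11_odd[of 0 \<tau>] by (simp add: \<theta>_def)
  have wronskian: "deriv P y * Q y = deriv Q y * P y" for y
  proof -
    have "((\<lambda>x. \<theta> (x + y) * \<theta> (x - y)) has_field_derivative 0) (at y)"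
      by (rule derivative_eq_intros DERIV_chain2[OF \<theta>'] refl)+
         (use zero \<open>\<theta> 0 = 0\<close> in \<open>simp add: \<theta>_def [symmetric]\<close>)
    moreover have "((\<lambda>x. P x * Q y - Q x * P y) has_field_derivative deriv P y * Q y - deriv Q y * P y) (at y)"
      by (rule derivative_eq_intros P' Q' refl)+ simp
    ultimately have "0 = deriv P y * Q y - deriv Q y * P y"
      unfolding addition by (rule DERIV_unique)
    then show ?thesis by simp
  qed
  have "P x * Q y = Q x * P y" for x y
  proof (cases "\<exists>a. P a \<noteq> 0")
    case False
    then show ?thesis by simp
  next
    case True
    then obtain a where "P a \<noteq> 0" by blast
    moreover have "isCont P a" using P' DERIV_isCont by blast
    ultimately obtain r where r: "r > 0" "\<And>x. x \<in> ball a r \<Longrightarrow> P x \<noteq> 0"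
      using continuous_at_avoid[of a P 0] by (auto simp: dist_commute)
    have "((\<lambda>x. Q x / P x) has_field_derivative 0) (at x within ball a r)" if "x \<in> ball a r" for x
    proof -
      have "((\<lambda>x. Q x / P x) has_field_derivative (deriv Q x * P x - Q x * deriv P x) / (P x * P x)) (at x)"
        by (rule DERIV_divide[OF Q' P' r(2)[OF that]])
      moreover have "deriv Q x * P x - Q x * deriv P x = 0"
        using wronskian[of x] by (simp add: mult.commute)
      ultimately show ?thesis
        by (auto intro: has_field_derivative_at_within)
    qed
    then have "\<exists>c. \<forall>x\<in>ball a r. Q x / P x = c"
      by (rule has_field_derivative_zero_constant[OF convex_ball])
    then obtain c where c: "\<And>x. x \<in> ball a r \<Longrightarrow> Q x / P x = c"
      by blast
    have "Q x - c * P x = 0" for x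
    proof (rule analytic_continuation[of "\<lambda>x. Q x - c * P x" UNIV "ball a r" a])
      show "(\<lambda>x. Q x - c * P x) holomorphic_on UNIV"
        using hol by (intro holomorphic_intros)
      show "Q x - c * P x = 0" if "x \<in> ball a r" for x
        using c[OF that] r(2)[OF that] by (simp add: field_simps)
    qed (use \<open>r > 0\<close> in \<open>auto simp: islimpt_ball\<close>)
    then show ?thesis by simp
  qed
  then have "\<theta> z * \<theta> z = 0"
    using addition[of z 0] by simp
  then show ?thesis by (simp add: \<theta>_def)
qed

section \<open>The characteristics 1/5 and 3/5\<close>

lemma root_of_unity_5_cubed: "root_of_unity 5 ^ 3 = ee (3 / 5)"
  by (simp add: root_of_unity_def ee_def exp_of_nat_mult [symmetric] algebra_simps)

text \<open>
  These are the two instances of \<open>theta_char_product_deriv\<close> in which three characteristics agree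
  and, up to sign and even integers, only \<open>1/5\<close> and \<open>3/5\<close> occur. For the second, the fourth characteristic is
  \<open>17/5 = -3/5 + 4\<close>, and those on the right are \<open>1/5 + 1/5 - 1 = -3/5\<close>; both are reflected to \<open>3/5\<close>,
  each at the cost of a factor \<open>\<kappa>\<close>, and the reflection changes the sign of \<open>B'\<close>.
\<close>
lemma theta_char_fifths_deriv:
  assumes \<tau>: "Im \<tau> > 0"
  defines "A \<equiv> theta_const (1/5) 1 \<tau>" and "B \<equiv> theta_const (3/5) 1 \<tau>"
    and "A' \<equiv> theta_deriv (1/5) 1 \<tau>" and "B' \<equiv> theta_deriv (3/5) 1 \<tau>"
    and "K \<equiv> root_of_unity 5 ^ 3 * theta_deriv 1 1 \<tau>"
  shows "3 * B' * A * B\<^sup>2 + A' * B ^ 3 = - K * A ^ 3"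
    and "3 * A' * A\<^sup>2 * B - B' * A ^ 3 = - K * B ^ 3"
proof -
  define \<theta> where "\<theta> = (\<lambda>\<epsilon> z. theta_char \<epsilon> 1 z \<tau>)"
  have \<theta>': "(\<theta> \<epsilon> has_field_derivative deriv (\<theta> \<epsilon>) z) (at z)" for \<epsilon> z
    unfolding \<theta>_def by (rule theta_char_has_field_derivative[OF \<tau>])
  have AB: "A = \<theta> (1/5) 0" "B = \<theta> (3/5) 0" "A' = deriv (\<theta> (1/5)) 0" "B' = deriv (\<theta> (3/5)) 0"
    by (simp_all add: A_def B_def A'_def B'_def \<theta>_def theta_const_def theta_deriv_def)
  have K: "K = ee (3/5) * deriv (\<theta> 1) 0"
    by (simp add: K_def root_of_unity_5_cubed theta_deriv_def \<theta>_def)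
  have prod: "((\<lambda>z. \<theta> \<epsilon> z * \<theta> \<epsilon> z * \<theta> \<epsilon> z * \<theta> \<delta> z) has_field_derivative
      - ee ((of_real \<delta> - 1) / 2) * deriv (\<theta> 1) 0 * \<theta> (2 * \<epsilon> - 1) 0 ^ 3) (at 0)"
    if "3 * \<epsilon> + \<delta> = 4" for \<epsilon> \<delta>
    using theta_char_product_deriv[OF \<tau>, of \<epsilon> \<epsilon> \<epsilon> \<delta>] that
    by (simp add: \<theta>_def power3_eq_cube mult.assoc)
  have shift: "\<theta> (\<epsilon> + 2) = \<theta> \<epsilon>" for \<epsilon>
    by (simp add: \<theta>_def theta_char_add_2)

  have deriv_B3A: "((\<lambda>z. \<theta> (3/5) z * \<theta> (3/5) z * \<theta> (3/5) z * \<theta> (1/5) z) has_field_derivative - K * A ^ 3) (at 0)"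
    using prod[of "3/5" "11/5"] shift[of "1/5"] by (simp add: K AB)
  have "((\<lambda>z. \<theta> (3/5) z * \<theta> (3/5) z * \<theta> (3/5) z * \<theta> (1/5) z) has_field_derivative
      3 * B' * A * B\<^sup>2 + A' * B ^ 3) (at 0)"
    by (rule derivative_eq_intros \<theta>' refl)+ (simp add: AB power2_eq_square power3_eq_cube algebra_simps)
  from DERIV_unique[OF this deriv_B3A] show "3 * B' * A * B\<^sup>2 + A' * B ^ 3 = - K * A ^ 3" .

  define \<kappa> where "\<kappa> = ee (- (3/10))"
  have \<kappa>: "ee (6/5) * \<kappa> ^ 2 = ee (3/5)"
    by (simp add: \<kappa>_def power2_eq_square ee_add [symmetric])
  have reflect: "\<theta> (- 3/5) z = \<kappa> * \<theta> (3/5) (- z)" for z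
    using theta_char_minus[of "- 3/5" "- z" \<tau>] by (simp add: \<theta>_def \<kappa>_def)
  have \<theta>_17: "\<theta> (17/5) = (\<lambda>z. \<kappa> * \<theta> (3/5) (- z))"
    using shift[of "7/5"] shift[of "- 3/5"] reflect by (simp add: fun_eq_iff)
  have deriv_A3B: "((\<lambda>z. \<theta> (1/5) z * \<theta> (1/5) z * \<theta> (1/5) z * (\<kappa> * \<theta> (3/5) (- z))) has_field_derivative
      - ee (6/5) * deriv (\<theta> 1) 0 * (\<kappa> * B) ^ 3) (at 0)"
    using prod[of "1/5" "17/5"] reflect[of 0] by (simp add: AB \<theta>_17)
  have "((\<lambda>z. \<theta> (1/5) z * \<theta> (1/5) z * \<theta> (1/5) z * (\<kappa> * \<theta> (3/5) (- z))) has_field_derivative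
      \<kappa> * (3 * A' * A\<^sup>2 * B - B' * A ^ 3)) (at 0)"
    by (rule derivative_eq_intros \<theta>' DERIV_chain2[OF \<theta>'] refl)+
       (simp add: AB power2_eq_square power3_eq_cube algebra_simps)
  from DERIV_unique[OF this deriv_A3B] have "\<kappa> * (3 * A' * A\<^sup>2 * B - B' * A ^ 3) = - ee (6/5) * deriv (\<theta> 1) 0 * (\<kappa> * B) ^ 3" .
  also have "\<dots> = \<kappa> * (- (ee (6/5) * \<kappa> ^ 2) * deriv (\<theta> 1) 0 * B ^ 3)"
    by (simp add: power2_eq_square power3_eq_cube)
  also have "\<dots> = \<kappa> * (- K * B ^ 3)"
    by (simp only: \<kappa> K) simp
  finally show "3 * A' * A\<^sup>2 * B - B' * A ^ 3 = - K * B ^ 3"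
    by (rule mult_left_cancel[THEN iffD1, rotated]) (simp add: \<kappa>_def)
qed

text \<open>
  Cleared of denominators, the unknowns are isolated by \<open>A\<^sup>2\<close> times the first plus \<open>3 B\<^sup>2\<close> times
  the second equation, and by \<open>3 A\<^sup>2\<close> times the first minus \<open>B\<^sup>2\<close> times the second.
\<close>
lemma log_derivs_from_linear_system:
  fixes A B A' B' K :: complex
  assumes AB: "A \<noteq> 0" "B \<noteq> 0"
    and 1: "3 * B' * A * B\<^sup>2 + A' * B ^ 3 = - K * A ^ 3"
    and 2: "3 * A' * A\<^sup>2 * B - B' * A ^ 3 = - K * B ^ 3"
  shows "A' / A = - K * ((A ^ 5 + 3 * B ^ 5) / (10 * A ^ 3 * B ^ 3))"
    and "B' / B = - K * ((3 * A ^ 5 - B ^ 5) / (10 * A ^ 3 * B ^ 3))"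
proof -
  have "10 * A' * A\<^sup>2 * B ^ 3 = - K * (A ^ 5 + 3 * B ^ 5)"
    using 1 2 by algebra
  then show "A' / A = - K * ((A ^ 5 + 3 * B ^ 5) / (10 * A ^ 3 * B ^ 3))"
    using AB by (simp add: divide_simps) algebra
  have "10 * B' * A ^ 3 * B\<^sup>2 = - K * (3 * A ^ 5 - B ^ 5)"
    using 1 2 by algebra
  then show "B' / B = - K * ((3 * A ^ 5 - B ^ 5) / (10 * A ^ 3 * B ^ 3))"
    using AB by (simp add: divide_simps) algebra
qed

theorem theorem4p3:
  fixes \<tau> :: complex
  assumes "Im \<tau> > 0"
  shows "theta_deriv (1/5) 1 \<tau> / theta_const (1/5) 1 \<tau> =
           - (root_of_unity 5 ^ 3) * theta_deriv 1 1 \<tau> *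
             ((theta_const (1/5) 1 \<tau> ^ 5 + 3 * theta_const (3/5) 1 \<tau> ^ 5) /
              (10 * theta_const (1/5) 1 \<tau> ^ 3 * theta_const (3/5) 1 \<tau> ^ 3))
       \<and> theta_deriv (3/5) 1 \<tau> / theta_const (3/5) 1 \<tau> =
           - (root_of_unity 5 ^ 3) * theta_deriv 1 1 \<tau> *
             ((3 * theta_const (1/5) 1 \<tau> ^ 5 - theta_const (3/5) 1 \<tau> ^ 5) /
              (10 * theta_const (1/5) 1 \<tau> ^ 3 * theta_const (3/5) 1 \<tau> ^ 3))"
proof (cases "theta_const (1/5) 1 \<tau> = 0 \<or> theta_const (3/5) 1 \<tau> = 0")
  case False
  then show ?thesis
    using log_derivs_from_linear_system[OF _ _ theta_char_fifths_deriv[OF assms]] by simp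
next
  case True
  have "theta_const (1/5) 1 \<tau> = 0 \<and> theta_const (3/5) 1 \<tau> = 0"
  proof (cases "theta_deriv 1 1 \<tau> = 0")
    case True
    then have "theta_char 1 1 z \<tau> = 0" for z
      using theta_11_deriv_0_eq_0_imp_eq_0[OF assms] by (simp add: theta_deriv_def)
    then show ?thesis
      using theta_char_eq_theta_11[of "1/5" "- 2/5"] theta_char_eq_theta_11[of "3/5" "- 1/5"]
      by (simp add: theta_const_def)
  next
    case False
    moreover have "root_of_unity 5 \<noteq> 0"
      by (simp add: root_of_unity_def)
    moreover note theta_char_fifths_deriv[OF assms]
    ultimately show ?thesis
      using True by (elim disjE) simp_all
  qed
  then show ?thesis by simp
qed

end
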